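(* Let $X$ be a (finite or infinite) set with $|X|\ge2$, and let $\mathcal T_X$ be the full transformation semigroup on $X$. Then $$\operatorname{Aut}^-(\mathcal T_X)=\emptyset,\qquad \operatorname{Aut}^{\pm}(\mathcal T_X)=\operatorname{Aut}(\mathcal T_X)\cong\operatorname{Sym}(X),\qquad \mathscr C(\mathcal T_X)=\{\mathrm{id}\}.$$
   Context: $\mathcal T_X$ is the semigroup of all functions $X\to X$ under composition; $\operatorname{Sym}(X)$ is the group of all permutations of $X$. For a semigroup $S$: $\operatorname{Aut}(S)$ is the set of automorphisms of $S$; $\operatorname{Aut}^-(S)$ is the set of anti-automorphisms, i.e. bijections $\alpha:S\to S$ with $\alpha(xy)=\alpha(y)\alpha(x)$ for all $x,y\in S$; $\operatorname{Aut}^{\pm}(S)=\operatorname{Aut}(S)\cup\operatorname{Aut}^-(S)$, a group under composition. $I(S)=\{\alpha\in\operatorname{Aut}^-(S):\alpha^2=\mathrm{id}_S\neq\alpha\}$ is the set of involutions of $S$, and $\mathscr C(S)=\langle I(S)\rangle\le\operatorname{Aut}^{\pm}(S)$, interpreted as $\{\mathrm{id}_S\}$ if $I(S)=\emptyset$. *)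

theory Defs
  imports "HOL-Algebra.Bij" "HOL-Algebra.Generated_Groups"
begin

text \<open>
  The set \<^term>\<open>X\<close> is a subset of an arbitrary type. As in theory \<^theory>\<open>HOL-Algebra.Bij\<close>, maps on a
  carrier set are represented by extensional functions, so that equality of maps on the set is
  equality of terms; \<^term>\<open>BijGroup X\<close> is then \<open>Sym(X)\<close>. The constant \<^const>\<open>hom\<close>, and hence
  \<^const>\<open>auto\<close> and \<^const>\<open>AutoGroup\<close>, mention only the carrier and the multiplication of a structure,
  so they are the semigroup notions: the field \<open>one\<close> of the record plays no role in them.
\<close>

definition full_transf :: "'a set \<Rightarrow> ('a \<Rightarrow> 'a) monoid"
  where "full_transf X =
    \<lparr>carrier = X \<rightarrow>\<^sub>E X,
     mult = (\<lambda>f g. compose X f g),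
     one = (\<lambda>x\<in>X. x)\<rparr>"

definition anti_auto :: "('a, 'b) monoid_scheme \<Rightarrow> ('a \<Rightarrow> 'a) set"
  where "anti_auto S =
    {\<alpha> \<in> Bij (carrier S).
      \<forall>x\<in>carrier S. \<forall>y\<in>carrier S. \<alpha> (x \<otimes>\<^bsub>S\<^esub> y) = \<alpha> y \<otimes>\<^bsub>S\<^esub> \<alpha> x}"

definition AutoAntiGroup :: "('a, 'b) monoid_scheme \<Rightarrow> ('a \<Rightarrow> 'a) monoid"
  where "AutoAntiGroup S = BijGroup (carrier S) \<lparr>carrier := auto S \<union> anti_auto S\<rparr>"

definition anti_involutions :: "('a, 'b) monoid_scheme \<Rightarrow> ('a \<Rightarrow> 'a) set"
  where "anti_involutions S =
    {\<alpha> \<in> anti_auto S.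
      compose (carrier S) \<alpha> \<alpha> = (\<lambda>x\<in>carrier S. x) \<and> \<alpha> \<noteq> (\<lambda>x\<in>carrier S. x)}"

text \<open>The inductive set \<^const>\<open>generate\<close> always contains the identity, so the subgroup generated by
  no involutions is trivial.\<close>

definition involution_subgroup :: "('a, 'b) monoid_scheme \<Rightarrow> ('a \<Rightarrow> 'a) set"
  where "involution_subgroup S = generate (AutoAntiGroup S) (anti_involutions S)"

lemma monoid_full_transf: "monoid (full_transf X)"
proof (rule monoidI)
  fix f g h
  assume "f \<in> carrier (full_transf X)" "g \<in> carrier (full_transf X)" "h \<in> carrier (full_transf X)"
  then show "f \<otimes>\<^bsub>full_transf X\<^esub> g \<otimes>\<^bsub>full_transf X\<^esub> h
      = f \<otimes>\<^bsub>full_transf X\<^esub> (g \<otimes>\<^bsub>full_transf X\<^esub> h)"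
    by (auto simp: full_transf_def compose_def fun_eq_iff restrict_def PiE_def Pi_def)
qed (auto simp: full_transf_def compose_def fun_eq_iff restrict_def PiE_def Pi_def extensional_def)

lemma subgroup_auto_anti_auto:
  assumes closed: "mult S \<in> carrier S \<rightarrow> carrier S \<rightarrow> carrier S"
  shows "subgroup (auto S \<union> anti_auto S) (BijGroup (carrier S))"
proof (rule subgroup.intro)
  show "auto S \<union> anti_auto S \<subseteq> carrier (BijGroup (carrier S))"
    by (auto simp: auto_def anti_auto_def BijGroup_def)
next
  have mem: "x \<otimes>\<^bsub>S\<^esub> y \<in> carrier S" if "x \<in> carrier S" "y \<in> carrier S" for x y
    using closed that by auto
  fix a b
  assume ab: "a \<in> auto S \<union> anti_auto S" "b \<in> auto S \<union> anti_auto S"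
  then have B: "a \<in> Bij (carrier S)" "b \<in> Bij (carrier S)"
    by (auto simp: auto_def anti_auto_def)
  then have m: "a x \<in> carrier S" "b x \<in> carrier S" if "x \<in> carrier S" for x
    using that Bij_imp_funcset by blast+
  have "compose (carrier S) a b \<in> auto S \<union> anti_auto S"
    using ab compose_Bij[OF B] m mem
    by (auto simp: auto_def anti_auto_def hom_def compose_def)
  then show "a \<otimes>\<^bsub>BijGroup (carrier S)\<^esub> b \<in> auto S \<union> anti_auto S"
    using B by (simp add: BijGroup_def)
next
  show "\<one>\<^bsub>BijGroup (carrier S)\<^esub> \<in> auto S \<union> anti_auto S"
    using closed id_Bij by (auto simp: BijGroup_def auto_def hom_def Pi_def)
next
  have mem: "x \<otimes>\<^bsub>S\<^esub> y \<in> carrier S" if "x \<in> carrier S" "y \<in> carrier S" for x y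
    using closed that by auto
  fix a
  assume a: "a \<in> auto S \<union> anti_auto S"
  then have B: "a \<in> Bij (carrier S)"
    by (auto simp: auto_def anti_auto_def)
  let ?i = "\<lambda>x\<in>carrier S. inv_into (carrier S) a x"
  have iB: "?i \<in> Bij (carrier S)"
    using B by (rule restrict_inv_into_Bij)
  have "?i \<in> auto S \<union> anti_auto S"
  proof (cases "a \<in> auto S")
    case True
    then have "?i \<in> hom S S"
      by (auto simp: hom_def auto_def mem Bij_inv_into_mem[OF B]
          intro!: Bij_inv_into_lemma[OF _ B closed])
    then show ?thesis
      using iB by (simp add: auto_def)
  next
    case False
    then have anti: "a (x \<otimes>\<^bsub>S\<^esub> y) = a y \<otimes>\<^bsub>S\<^esub> a x" if "x \<in> carrier S" "y \<in> carrier S" for x y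
      using a that by (auto simp: anti_auto_def)
    have bij: "bij_betw a (carrier S) (carrier S)"
      using B by (simp add: Bij_def)
    have "?i (x \<otimes>\<^bsub>S\<^esub> y) = ?i y \<otimes>\<^bsub>S\<^esub> ?i x" if "x \<in> carrier S" "y \<in> carrier S" for x y
    proof -
      have "a (?i y \<otimes>\<^bsub>S\<^esub> ?i x) = x \<otimes>\<^bsub>S\<^esub> y"
        using that by (simp add: anti Bij_inv_into_mem[OF B] bij_betw_inv_into_right[OF bij])
      moreover have "?i y \<otimes>\<^bsub>S\<^esub> ?i x \<in> carrier S"
        using that by (simp add: mem Bij_inv_into_mem[OF B])
      ultimately show ?thesis
        using bij_betw_inv_into_left[OF bij] mem that by (metis restrict_apply')
    qed
    then show ?thesis
      using iB by (simp add: anti_auto_def)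
  qed
  then show "inv\<^bsub>BijGroup (carrier S)\<^esub> a \<in> auto S \<union> anti_auto S"
    using B by (simp add: inv_BijGroup)
qed

theorem group_AutoAntiGroup:
  assumes "mult S \<in> carrier S \<rightarrow> carrier S \<rightarrow> carrier S"
  shows "group (AutoAntiGroup S)"
  unfolding AutoAntiGroup_def
  by (rule subgroup.subgroup_is_group[OF subgroup_auto_anti_auto[OF assms] group_BijGroup])

end

(* The elements z of T_X with z f = z for all f are exactly the constant maps, whereas no z satisfies
   f z = z for all f once X has two points; an anti-automorphism would turn the former into the latter.
   An automorphism permutes the constant maps, hence induces a permutation s of X, and evaluating
   on f c_x = c_(f x) shows that the automorphism is conjugation by s. *)
theory Submission
  imports Defs
begin

lemma carrier_full_transf [simp]: "carrier (full_transf X) = X \<rightarrow>\<^sub>E X"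
  by (simp add: full_transf_def)

lemma mult_full_transf [simp]: "f \<otimes>\<^bsub>full_transf X\<^esub> g = compose X f g"
  by (simp add: full_transf_def)

lemma compose_PiE: "f \<in> B \<rightarrow>\<^sub>E C \<Longrightarrow> g \<in> A \<rightarrow>\<^sub>E B \<Longrightarrow> compose A f g \<in> A \<rightarrow>\<^sub>E C"
  by (auto simp: compose_def)

lemma compose_const_left: "f \<in> X \<rightarrow> X \<Longrightarrow> compose X (\<lambda>_\<in>X. x) f = (\<lambda>_\<in>X. x)"
  by (auto simp: compose_def restrict_def fun_eq_iff)

text \<open>Left multiplication acts on constant maps exactly as \<open>f\<close> acts on points, so
  the values of a map can be read off inside the semigroup.\<close>

lemma compose_const_right: "x \<in> X \<Longrightarrow> compose X f (\<lambda>_\<in>X. x) = (\<lambda>_\<in>X. f x)"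
  by (auto simp: compose_def restrict_def fun_eq_iff)

text \<open>Multiplying \<open>z\<close> on the right by a single constant map already forces
  \<open>z\<close> to be constant. The left-hand side uses multiplication only, so automorphisms
  must respect constancy.\<close>

lemma left_zero_full_transf_iff:
  assumes "X \<noteq> {}" and z: "z \<in> X \<rightarrow>\<^sub>E X"
  shows "(\<forall>f\<in>X \<rightarrow>\<^sub>E X. compose X z f = z) \<longleftrightarrow> (\<exists>x\<in>X. z = (\<lambda>_\<in>X. x))"
proof
  assume L: "\<forall>f\<in>X \<rightarrow>\<^sub>E X. compose X z f = z"
  obtain a where a: "a \<in> X" using assms by blast
  then have "z = compose X z (\<lambda>_\<in>X. a)" using L by simp
  also have "\<dots> = (\<lambda>_\<in>X. z a)" using a by (rule compose_const_right)
  finally show "\<exists>x\<in>X. z = (\<lambda>_\<in>X. x)" using PiE_mem[OF z a] by blast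
qed (auto simp: compose_const_left PiE_def)

lemma anti_auto_full_transf_empty:
  assumes "a \<in> X" "b \<in> X" "a \<noteq> b"
  shows "anti_auto (full_transf X) = {}"
proof (rule ccontr)
  let ?T = "X \<rightarrow>\<^sub>E X"
  let ?c = "\<lambda>x. \<lambda>_\<in>X. x"
  assume "anti_auto (full_transf X) \<noteq> {}"
  then obtain \<alpha> where \<alpha>: "bij_betw \<alpha> ?T ?T"
    and anti: "\<And>f g. f \<in> ?T \<Longrightarrow> g \<in> ?T \<Longrightarrow> \<alpha> (compose X f g) = compose X (\<alpha> g) (\<alpha> f)"
    by (auto simp: anti_auto_def Bij_def)
  have c: "?c x \<in> ?T" if "x \<in> X" for x using that by auto
  \<comment> \<open>Every \<open>g\<close> is some \<open>\<alpha> f\<close> by surjectivity, and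
    reversing the product turns the left zero \<open>?c a\<close> into a right zero.\<close>
  have right_zero: "compose X g (\<alpha> (?c a)) = \<alpha> (?c a)" if "g \<in> ?T" for g
  proof -
    have "g \<in> \<alpha> ` ?T" using that by (simp only: bij_betw_imp_surj_on[OF \<alpha>])
    then obtain f where f: "f \<in> ?T" "g = \<alpha> f" by (elim imageE)
    then have "compose X g (\<alpha> (?c a)) = \<alpha> (compose X (?c a) f)"
      using anti c assms by simp
    also have "\<dots> = \<alpha> (?c a)" using f by (simp add: compose_const_left PiE_def)
    finally show ?thesis .
  qed
  have "\<alpha> (?c a) \<in> X \<rightarrow> X"
    using bij_betw_apply[OF \<alpha> c[OF assms(1)]] by (simp add: PiE_def)
  \<comment> \<open>Taking \<open>g\<close> to be \<open>?c a\<close> and then \<open>?c b\<close>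
    equates the right zero with both constants.\<close>
  then have "?c a = ?c b"
    using right_zero[OF c[OF assms(1)]] right_zero[OF c[OF assms(2)]] by (simp add: compose_const_left)
  from fun_cong[OF this, of a] show False using assms by simp
qed

text \<open>This is the conjugation \<open>f\<close> to \<open>s f s^-1\<close>. The inner
  restriction keeps the result in the carrier; the outer one makes the map itself extensional, as
  membership in \<open>Bij\<close> requires.\<close>

definition conj_transf :: "'a set \<Rightarrow> ('a \<Rightarrow> 'a) \<Rightarrow> ('a \<Rightarrow> 'a) \<Rightarrow> 'a \<Rightarrow> 'a"
  where "conj_transf X s = (\<lambda>f\<in>X \<rightarrow>\<^sub>E X. \<lambda>x\<in>X. s (f (inv_into X s x)))"

lemma Bij_closed: "s \<in> Bij X \<Longrightarrow> x \<in> X \<Longrightarrow> s x \<in> X"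
  by (meson Bij_imp_funcset funcset_mem)

lemma conj_transf_closed:
  assumes s: "s \<in> Bij X" and f: "f \<in> X \<rightarrow>\<^sub>E X"
  shows "conj_transf X s f \<in> X \<rightarrow>\<^sub>E X"
proof -
  have "s (f (inv_into X s x)) \<in> X" if "x \<in> X" for x
    by (rule Bij_closed[OF s PiE_mem[OF f Bij_inv_into_mem[OF s that]]])
  then show ?thesis using f by (simp add: conj_transf_def)
qed

lemma conj_transf_apply:
  "s \<in> Bij X \<Longrightarrow> f \<in> X \<rightarrow>\<^sub>E X \<Longrightarrow> x \<in> X \<Longrightarrow> conj_transf X s f (s x) = s (f x)"
  by (simp add: conj_transf_def Bij_closed) (simp add: Bij_def bij_betw_def)

text \<open>Since \<open>s\<close> maps onto \<open>X\<close>, the relation \<open>g s = s f\<close>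
  determines \<open>g\<close>. Conjugates can thus be identified without handling
  \<open>inv_into\<close>.\<close>

lemma conj_transf_eqI:
  assumes s: "s \<in> Bij X" and fg: "f \<in> X \<rightarrow>\<^sub>E X" "g \<in> X \<rightarrow>\<^sub>E X"
    and eq: "\<And>x. x \<in> X \<Longrightarrow> g (s x) = s (f x)"
  shows "conj_transf X s f = g"
proof (rule PiE_ext[OF conj_transf_closed[OF s fg(1)] fg(2)])
  fix y assume "y \<in> X"
  then obtain x where "x \<in> X" "y = s x" using s unfolding Bij_def bij_betw_def by blast
  then show "conj_transf X s f y = g y" using conj_transf_apply[OF s fg(1)] eq by simp
qed

lemma conj_transf_const:
  assumes "s \<in> Bij X" "x \<in> X"
  shows "conj_transf X s (\<lambda>_\<in>X. x) = (\<lambda>_\<in>X. s x)"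
proof (rule conj_transf_eqI)
  show "(\<lambda>_\<in>X. s x) \<in> X \<rightarrow>\<^sub>E X" "\<And>y. y \<in> X \<Longrightarrow> (\<lambda>_\<in>X. s x) (s y) = s ((\<lambda>_\<in>X. x) y)"
    using assms by (simp_all add: Bij_closed)
qed (use assms in simp_all)

text \<open>Both sides send \<open>s (t x)\<close> to \<open>s (t (f x))\<close>. This provides the
  homomorphism property in \<open>s\<close> as well as the inverse of a conjugation.\<close>

lemma conj_transf_compose:
  assumes s: "s \<in> Bij X" and t: "t \<in> Bij X" and f: "f \<in> X \<rightarrow>\<^sub>E X"
  shows "conj_transf X (compose X s t) f = conj_transf X s (conj_transf X t f)"
proof (rule conj_transf_eqI[OF compose_Bij[OF s t] f])
  note tf = conj_transf_closed[OF t f]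
  show "conj_transf X s (conj_transf X t f) \<in> X \<rightarrow>\<^sub>E X" by (rule conj_transf_closed[OF s tf])
  fix x assume x: "x \<in> X"
  then have "t x \<in> X" "f x \<in> X" using t f by (auto simp: Bij_closed)
  then show "conj_transf X s (conj_transf X t f) (compose X s t x) = compose X s t (f x)"
    using x by (simp add: compose_eq conj_transf_apply s tf t f)
qed

lemma conj_transf_id: "f \<in> X \<rightarrow>\<^sub>E X \<Longrightarrow> conj_transf X (\<lambda>x\<in>X. x) f = f"
  by (rule conj_transf_eqI[OF id_Bij]) auto

lemma conj_transf_mult:
  assumes s: "s \<in> Bij X" and f: "f \<in> X \<rightarrow>\<^sub>E X" and g: "g \<in> X \<rightarrow>\<^sub>E X"
  shows "conj_transf X s (compose X f g) = compose X (conj_transf X s f) (conj_transf X s g)"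
proof (rule conj_transf_eqI[OF s])
  fix x assume x: "x \<in> X"
  then have "s x \<in> X" "g x \<in> X" using s g by (auto simp: Bij_closed)
  then show "compose X (conj_transf X s f) (conj_transf X s g) (s x) = s (compose X f g x)"
    using x by (simp add: compose_eq conj_transf_apply s f g)
qed (simp_all add: assms compose_PiE[of _ X X] conj_transf_closed)

lemma conj_transf_auto:
  assumes s: "s \<in> Bij X"
  shows "conj_transf X s \<in> auto (full_transf X)"
proof -
  let ?t = "\<lambda>x\<in>X. inv_into X s x"
  have t: "?t \<in> Bij X" by (rule restrict_inv_into_Bij[OF s])
  have ts: "compose X ?t s = (\<lambda>x\<in>X. x)"
    using s by (intro Bij_compose_restrict_eq)
  have st: "compose X s ?t = (\<lambda>x\<in>X. x)"
    using s by (simp add: Bij_def compose_id_inv_into bij_betw_imp_surj_on)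
  \<comment> \<open>The inverse is conjugation by the inverse permutation \<open>?t\<close>.\<close>
  have "bij_betw (conj_transf X s) (X \<rightarrow>\<^sub>E X) (X \<rightarrow>\<^sub>E X)"
  proof (rule bij_betw_byWitness)
    show "\<forall>f\<in>X \<rightarrow>\<^sub>E X. conj_transf X ?t (conj_transf X s f) = f"
      by (simp add: conj_transf_compose[OF t s, symmetric] ts conj_transf_id)
    show "\<forall>f\<in>X \<rightarrow>\<^sub>E X. conj_transf X s (conj_transf X ?t f) = f"
      by (simp add: conj_transf_compose[OF s t, symmetric] st conj_transf_id)
  qed (intro image_subsetI conj_transf_closed s t, assumption)+
  then show ?thesis
    using conj_transf_closed[OF s]
    by (simp add: auto_def hom_def Bij_def conj_transf_mult[OF s]) (simp add: conj_transf_def)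
qed

text \<open>The constant maps are copies of the points of \<open>X\<close> inside the semigroup, and
  \<open>s\<close> is \<open>\<alpha>\<close> read on these copies.\<close>

lemma auto_full_transf_eq_conj:
  assumes ne: "X \<noteq> {}" and auto: "\<alpha> \<in> auto (full_transf X)"
  obtains s where "s \<in> Bij X" "\<alpha> = conj_transf X s"
proof -
  let ?T = "X \<rightarrow>\<^sub>E X"
  let ?c = "\<lambda>x. \<lambda>_\<in>X. x"
  have bij: "bij_betw \<alpha> ?T ?T" and ext: "\<alpha> \<in> extensional ?T"
    and mult: "\<And>f g. f \<in> ?T \<Longrightarrow> g \<in> ?T \<Longrightarrow> \<alpha> (compose X f g) = compose X (\<alpha> f) (\<alpha> g)"
    using auto by (auto simp: auto_def Bij_def hom_def)
  have \<alpha>T: "\<alpha> f \<in> ?T" if "f \<in> ?T" for f by (rule bij_betw_apply[OF bij that])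
  have c: "?c x \<in> ?T" if "x \<in> X" for x using that by auto
  have c_eq: "x = y" if "?c x = ?c y" for x y
  proof -
    obtain z where "z \<in> X" using ne by blast
    then show ?thesis using fun_cong[OF that, of z] by simp
  qed
  \<comment> \<open>Surjectivity of \<open>\<alpha>\<close> lets \<open>g\<close> range over images
    only, and injectivity then cancels \<open>\<alpha>\<close>.\<close>
  have left_zero: "(\<forall>g\<in>?T. compose X (\<alpha> z) g = \<alpha> z) \<longleftrightarrow> (\<forall>f\<in>?T. compose X z f = z)"
    if z: "z \<in> ?T" for z
  proof -
    have "(\<forall>g\<in>?T. compose X (\<alpha> z) g = \<alpha> z) \<longleftrightarrow> (\<forall>g\<in>\<alpha> ` ?T. compose X (\<alpha> z) g = \<alpha> z)"
      using bij by (simp add: bij_betw_def)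
    also have "\<dots> \<longleftrightarrow> (\<forall>f\<in>?T. \<alpha> (compose X z f) = \<alpha> z)" using mult z by simp
    also have "\<dots> \<longleftrightarrow> (\<forall>f\<in>?T. compose X z f = z)"
      using inj_on_eq_iff[OF bij_betw_imp_inj_on[OF bij] compose_PiE[OF z] z] by simp
    finally show ?thesis .
  qed
  \<comment> \<open>From right to left this defines \<open>s\<close>; from left to right it makes
    \<open>s\<close> surjective, because the preimage of a constant map is constant.\<close>
  have const_iff: "(\<exists>y\<in>X. \<alpha> z = ?c y) \<longleftrightarrow> (\<exists>x\<in>X. z = ?c x)" if "z \<in> ?T" for z
    using left_zero[OF that] left_zero_full_transf_iff[OF ne] that \<alpha>T[OF that] by simp
  have "\<exists>y\<in>X. \<alpha> (?c x) = ?c y" if "x \<in> X" for x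
    unfolding const_iff[OF c[OF that]] by (rule bexI[of _ x]) (simp_all add: that)
  then obtain s0 where s0: "\<And>x. x \<in> X \<Longrightarrow> s0 x \<in> X" "\<And>x. x \<in> X \<Longrightarrow> \<alpha> (?c x) = ?c (s0 x)"
    by metis
  define s where "s = restrict s0 X"
  have sX: "s x \<in> X" and \<alpha>c: "\<alpha> (?c x) = ?c (s x)" if "x \<in> X" for x
    using s0 that by (auto simp: s_def)
  have "inj_on s X"
  proof (rule inj_onI)
    fix x y assume xy: "x \<in> X" "y \<in> X" "s x = s y"
    then have "\<alpha> (?c x) = \<alpha> (?c y)" by (simp add: \<alpha>c)
    then have "?c x = ?c y" by (rule inj_onD[OF bij_betw_imp_inj_on[OF bij] _ c[OF xy(1)] c[OF xy(2)]])
    then show "x = y" by (rule c_eq)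
  qed
  moreover have "y \<in> s ` X" if y: "y \<in> X" for y
  proof -
    have "?c y \<in> \<alpha> ` ?T" using c[OF y] by (simp only: bij_betw_imp_surj_on[OF bij])
    then obtain f where f: "f \<in> ?T" "\<alpha> f = ?c y" by (elim imageE) simp
    then have "\<exists>x\<in>X. f = ?c x" using const_iff[OF f(1)] y by blast
    then obtain x where x: "x \<in> X" "f = ?c x" by (elim bexE)
    then have "?c (s x) = ?c y" using f \<alpha>c by simp
    then have "s x = y" by (rule c_eq)
    then show ?thesis using x by blast
  qed
  ultimately have s: "s \<in> Bij X"
    using sX by (auto simp: Bij_def bij_betw_def s_def)
  have "\<alpha> f = conj_transf X s f" if f: "f \<in> ?T" for f
  proof (rule conj_transf_eqI[OF s f \<alpha>T[OF f], symmetric])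
    fix x assume x: "x \<in> X"
    have fx: "f x \<in> X" using f x by (rule PiE_mem)
    \<comment> \<open>The image of the product of \<open>f\<close> and \<open>?c x\<close> is
      computed in two ways: by multiplicativity, and from the fact that this product is
      \<open>?c (f x)\<close>.\<close>
    have "?c (\<alpha> f (s x)) = compose X (\<alpha> f) (\<alpha> (?c x))"
      using x by (simp add: \<alpha>c compose_const_right sX)
    also have "\<dots> = \<alpha> (?c (f x))"
      using mult[OF f c[OF x]] x by (simp add: compose_const_right)
    also have "\<dots> = ?c (s (f x))" using fx by (rule \<alpha>c)
    finally show "\<alpha> f (s x) = s (f x)" by (rule c_eq)
  qed
  then have "\<alpha> = conj_transf X s"
    using ext by (intro extensionalityI[of _ ?T]) (auto simp: conj_transf_def)
  with s show thesis by (rule that)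
qed

text \<open>Injectivity holds because the conjugates of the constant maps reveal every value of the
  permutation; surjectivity is the classification of automorphisms as conjugations.\<close>

lemma conj_transf_iso:
  assumes ne: "X \<noteq> {}"
  shows "conj_transf X \<in> iso (BijGroup X) (AutoGroup (full_transf X))"
proof (rule isoI)
  have Bij: "conj_transf X s \<in> Bij (X \<rightarrow>\<^sub>E X)" if "s \<in> Bij X" for s
    using conj_transf_auto[OF that] by (simp add: auto_def)
  have "conj_transf X (compose X s t) = compose (X \<rightarrow>\<^sub>E X) (conj_transf X s) (conj_transf X t)"
    if "s \<in> Bij X" "t \<in> Bij X" for s t
    by (rule extensionalityI[of _ "X \<rightarrow>\<^sub>E X"])
      (simp_all add: compose_eq conj_transf_compose that, simp add: conj_transf_def)
  then show "conj_transf X \<in> hom (BijGroup X) (AutoGroup (full_transf X))"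
    by (auto simp: hom_def BijGroup_def AutoGroup_def conj_transf_auto Bij)
  have "inj_on (conj_transf X) (Bij X)"
  proof (rule inj_onI)
    fix s t assume st: "s \<in> Bij X" "t \<in> Bij X" and eq: "conj_transf X s = conj_transf X t"
    have "s x = t x" if x: "x \<in> X" for x
    proof -
      have "(\<lambda>_\<in>X. s x) = (\<lambda>_\<in>X. t x)"
        using conj_transf_const[OF st(1) x] conj_transf_const[OF st(2) x] eq by simp
      from fun_cong[OF this, of x] show ?thesis using x by simp
    qed
    then show "s = t" using st by (auto simp: Bij_def intro: extensionalityI)
  qed
  moreover have "conj_transf X ` Bij X = auto (full_transf X)"
    using conj_transf_auto auto_full_transf_eq_conj[OF ne] by blast
  ultimately show "bij_betw (conj_transf X) (carrier (BijGroup X)) (carrier (AutoGroup (full_transf X)))"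
    by (simp add: bij_betw_def BijGroup_def AutoGroup_def)
qed

theorem mainTheorem7:
  fixes X :: "'a set"
  assumes "infinite X \<or> 2 \<le> card X"
  shows "anti_auto (full_transf X) = {}
    \<and> AutoAntiGroup (full_transf X) = AutoGroup (full_transf X)
    \<and> AutoGroup (full_transf X) \<cong> BijGroup X
    \<and> involution_subgroup (full_transf X) = {\<lambda>f\<in>carrier (full_transf X). f}"
proof -
  \<comment> \<open>An infinite set has \<open>card X = 0\<close>, so
    \<open>card X \<noteq> 1\<close> covers both cases.\<close>
  have ne: "X \<noteq> {}" and "card X \<noteq> 1" using assms by auto
  then have "\<not> is_singleton X" by (simp only: is_singleton_altdef not_False_eq_True)
  then have "\<not> (\<forall>a\<in>X. \<forall>b\<in>X. a = b)" using is_singletonI'[OF ne] by blast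
  then obtain a b where "a \<in> X" "b \<in> X" "a \<noteq> b" by blast
  then have anti: "anti_auto (full_transf X) = {}" by (rule anti_auto_full_transf_empty)
  \<comment> \<open>Both records are \<open>BijGroup\<close> with a replaced carrier, so equal
    carriers give equality of the groups and not just an isomorphism.\<close>
  have AutoAnti: "AutoAntiGroup (full_transf X) = AutoGroup (full_transf X)"
    by (simp only: AutoAntiGroup_def AutoGroup_def anti Un_empty_right)
  have one: "\<one>\<^bsub>AutoAntiGroup (full_transf X)\<^esub> = (\<lambda>f\<in>carrier (full_transf X). f)"
    by (simp add: AutoAntiGroup_def BijGroup_def)
  \<comment> \<open>The group structure is needed to conclude that the empty set generates only the
    identity.\<close>
  have "group (AutoAntiGroup (full_transf X))"
    by (rule group_AutoAntiGroup) (simp add: compose_PiE[of _ X X])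
  moreover have "anti_involutions (full_transf X) = {}"
    by (simp add: anti_involutions_def anti)
  ultimately have "involution_subgroup (full_transf X) = {\<lambda>f\<in>carrier (full_transf X). f}"
    by (simp only: involution_subgroup_def group.generate_empty one)
  moreover have "AutoGroup (full_transf X) \<cong> BijGroup X"
    by (rule group.iso_sym[OF group_BijGroup is_isoI[OF conj_transf_iso[OF ne]]])
  ultimately show ?thesis using anti AutoAnti by blast
qed

end
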